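(* Let $G=(V,E)$ be a graph. Define $$(\partial G)^* = \left\{u \in V : \exists\, v \in V \text{ such that } d(w,v) \leq d(u,v) \text{ for all } w \text{ with } (u,w) \in E \right\}$$ and $$\partial G = \left\{u \in V : \exists\, v \in V \text{ such that } \frac{1}{\deg(u)} \sum_{w:\,(u, w) \in E} d(w,v) < d(u,v) \right\}.$$ Then $(\partial G)^* \subseteq \partial G$.
   Context: For a graph $G=(V,E)$ with vertex set $V$ and edge set $E$, $d(\cdot,\cdot)$ is the graph distance (number of edges in a shortest path) and $\deg(u)$ is the number of neighbors of $u$, i.e. of vertices $w$ with $(u,w)\in E$. $(\partial G)^*$ is called the Chartrand–Erwin–Johns–Zhang boundary of $G$, and $\partial G$ is called the boundary of $G$.
   Formalization: The graph is assumed connected (between components d is undefined, and with d = ∞ the claim fails, e.g. for a 3-vertex path plus a disjoint edge), with every deg(u) finite, and not a single vertex (there 1/deg(u) is undefined). *)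

theory Defs
  imports "Graph_Theory.Graph_Theory"
begin

text \<open>
  A simple undirected graph, finite or infinite, is a symmetric loop-free pair digraph
  (locale \<^locale>\<open>pair_bidirected_digraph\<close>): an undirected edge between u and w is
  represented by both ordered pairs (u, w) and (w, u) in \<open>parcs G\<close>.
\<close>

definition neighbors :: "'a pair_pre_digraph \<Rightarrow> 'a \<Rightarrow> 'a set" where
  "neighbors G u = {w. (u, w) \<in> parcs G}"

definition degree :: "'a pair_pre_digraph \<Rightarrow> 'a \<Rightarrow> nat" where
  "degree G u = card (neighbors G u)"

text \<open>
  With unit weights the library's shortest-path distance counts arcs; it is \<open>\<infinity>\<close> for vertices
  in different components.
\<close>

definition graph_dist :: "'a pair_pre_digraph \<Rightarrow> 'a \<Rightarrow> 'a \<Rightarrow> ereal" where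
  "graph_dist G u v = wf_digraph.\<mu> (with_proj G) (\<lambda>_. 1) u v"

text \<open>The Chartrand--Erwin--Johns--Zhang boundary.\<close>

definition cejz_boundary :: "'a pair_pre_digraph \<Rightarrow> 'a set" where
  "cejz_boundary G =
     {u \<in> pverts G. \<exists>v \<in> pverts G. \<forall>w. (u, w) \<in> parcs G \<longrightarrow> graph_dist G w v \<le> graph_dist G u v}"

text \<open>
  The average is meaningful only for a vertex of finite positive degree; for other vertices
  the factor \<open>1 / degree\<close> is \<open>0\<close> by the convention for division by zero.
\<close>

definition graph_boundary :: "'a pair_pre_digraph \<Rightarrow> 'a set" where
  "graph_boundary G =
     {u \<in> pverts G. \<exists>v \<in> pverts G.
        ereal (1 / real (degree G u)) * (\<Sum>w \<in> neighbors G u. graph_dist G w v) < graph_dist G u v}"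

end

theory Submission
  imports Defs
begin

text \<open>
  Every neighbour term of the average is at most \<open>d(u, v)\<close>, and the first step of a shortest
  path from \<open>u\<close> to \<open>v\<close> leads to a neighbour strictly closer to \<open>v\<close>, so the average is strictly
  smaller than \<open>d(u, v)\<close>. The same \<open>v\<close> therefore witnesses both conditions, provided that
  \<open>u \<noteq> v\<close>; and \<open>u = v\<close> is excluded because \<open>u\<close> has a neighbour, at positive distance from \<open>u\<close>.
\<close>

text \<open>Walk lengths are natural numbers, so some walk from \<open>u\<close> to \<open>v\<close>
  has least length; it attains the infimum that defines \<open>\<mu>\<close>. Hence the distance to
  a reachable vertex is a finite natural number.\<close>

lemma (in wf_digraph) unit_distance_attained:
  assumes "u \<rightarrow>\<^sup>* v"
  obtains p where "awalk u p v" "\<mu> (\<lambda>_. 1) u v = ereal (real (length p))"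
proof -
  have cost: "awalk_cost (\<lambda>_. 1) p = real (length p)" for p :: "'b awalk"
    by (induct p) auto
  from assms obtain p0 where "awalk u p0 v"
    by (auto simp: reachable_awalk)
  then obtain p where p: "awalk u p v" "\<And>q. awalk u q v \<Longrightarrow> length p \<le> length q"
    using ex_has_least_nat[of "\<lambda>p. awalk u p v" p0 length] by blast
  have "\<mu> (\<lambda>_. 1) u v = ereal (real (length p))"
    unfolding \<mu>_def
  proof (rule INF_eqI)
    show "ereal (real (length p)) \<le> ereal (awalk_cost (\<lambda>_. 1) q)"
      if "q \<in> {q. awalk u q v}" for q
      using that p(2) by (simp add: cost)
    show "y \<le> ereal (real (length p))"
      if "\<And>q. q \<in> {q. awalk u q v} \<Longrightarrow> y \<le> ereal (awalk_cost (\<lambda>_. 1) q)" for y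
      using that[of p] p(1) by (simp add: cost)
  qed
  with p(1) that show thesis by blast
qed

lemma (in wf_digraph) unit_distance_le_length:
  assumes "awalk u p v"
  shows "\<mu> (\<lambda>_. 1) u v \<le> ereal (real (length p))"
proof -
  have "awalk_cost (\<lambda>_. 1) p = real (length p)"
    by (induct p) auto
  then show ?thesis
    using min_cost_le_walk_cost[OF assms, of "\<lambda>_. 1"] by simp
qed

lemma (in wf_digraph) ex_closer_successor:
  assumes "u \<rightarrow>\<^sup>* v" "u \<noteq> v"
  obtains w where "u \<rightarrow> w" "\<mu> (\<lambda>_. 1) w v < \<mu> (\<lambda>_. 1) u v"
proof -
  from assms(1) obtain p where p: "awalk u p v" "\<mu> (\<lambda>_. 1) u v = ereal (real (length p))"
    by (rule unit_distance_attained)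
  from p(1) \<open>u \<noteq> v\<close> obtain e q where q: "p = e # q"
    by (cases p) (auto simp: awalk_Nil_iff)
  with p(1) have e: "e \<in> arcs G" "u = tail G e" "awalk (head G e) q v"
    by (auto simp: awalk_Cons_iff)
  \<comment> \<open>The rest \<open>q\<close> of the shortest walk \<open>p\<close> has one arc
    fewer, and its length bounds the distance from \<open>head G e\<close>.\<close>
  have "\<mu> (\<lambda>_. 1) (head G e) v < \<mu> (\<lambda>_. 1) u v"
    using unit_distance_le_length[OF e(3)] by (rule le_less_trans) (simp add: p(2) q)
  moreover have "u \<rightarrow> head G e"
    using e by (auto intro: in_arcs_imp_in_arcs_ends)
  ultimately show thesis using that by blast
qed

lemma (in wf_digraph) unit_distance_pos:
  assumes "u \<rightarrow>\<^sup>* v" "u \<noteq> v"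
  shows "0 < \<mu> (\<lambda>_. 1) u v"
proof -
  from assms(1) obtain p where p: "awalk u p v" "\<mu> (\<lambda>_. 1) u v = ereal (real (length p))"
    by (rule unit_distance_attained)
  with \<open>u \<noteq> v\<close> show ?thesis
    by (cases p) (auto simp: awalk_Nil_iff)
qed

text \<open>One strict inequality among weak ones makes the sum strictly smaller than
  \<open>card A\<close> times \<open>c\<close>. The element \<open>a\<close> also ensures that
  \<open>card A\<close> is nonzero, so the division is genuine.\<close>

lemma average_less:
  fixes f :: "'a \<Rightarrow> real"
  assumes "finite A" "\<And>x. x \<in> A \<Longrightarrow> f x \<le> c" "a \<in> A" "f a < c"
  shows "1 / real (card A) * sum f A < c"
proof -
  have "sum f A < (\<Sum>x\<in>A. c)"
    using assms by (intro sum_strict_mono_ex1) auto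
  moreover have "0 < card A"
    using assms by (auto simp: card_gt_0_iff)
  ultimately show ?thesis
    by (simp add: field_simps)
qed

theorem proposition1:
  fixes G :: "'a pair_pre_digraph"
  assumes graph: "pair_bidirected_digraph G"
    and connected: "connected (with_proj G)"
    and locally_finite: "\<And>u. u \<in> pverts G \<Longrightarrow> finite (neighbors G u)"
    and not_single_vertex: "\<And>u. pverts G \<noteq> {u}"
  shows "cejz_boundary G \<subseteq> graph_boundary G"
proof
  interpret pair_bidirected_digraph G by (rule graph)
  \<comment> \<open>Symmetry of the arcs turns connectedness into directed reachability, so all
    distances in \<open>G\<close> are finite.\<close>
  have "strongly_connected (with_proj G)"
    using pair_sym_arcs connected by (rule symmetric_connected_imp_strongly_connected)
  then have reach: "x \<rightarrow>\<^sup>*\<^bsub>with_proj G\<^esub> y" if "x \<in> pverts G" "y \<in> pverts G" for x y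
    using that by (auto simp: strongly_connected_def)
  fix u assume "u \<in> cejz_boundary G"
  then obtain v where u: "u \<in> pverts G" and v: "v \<in> pverts G"
    and le: "\<And>w. (u, w) \<in> parcs G \<Longrightarrow> graph_dist G w v \<le> graph_dist G u v"
    by (auto simp: cejz_boundary_def)
  \<comment> \<open>Replacing the extended-real distances to \<open>v\<close> by a natural-valued
    \<open>D\<close> lets the averaging argument run over the reals.\<close>
  have "\<exists>n. graph_dist G x v = ereal (real n)" if "x \<in> pverts G" for x
    using unit_distance_attained[OF reach[OF that v]] by (metis graph_dist_def)
  then obtain D :: "'a \<Rightarrow> nat" where D: "\<And>x. x \<in> pverts G \<Longrightarrow> graph_dist G x v = ereal (real (D x))"
    by metis
  have "u \<noteq> v"
  proof
    assume "u = v"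
    \<comment> \<open>A walk from \<open>u\<close> to another vertex \<open>x\<close> supplies a
      neighbour \<open>w\<close> of \<open>u\<close>. If \<open>u = v\<close>, then
      \<open>le\<close> forces the distance from \<open>w\<close> to \<open>u\<close> to be at most
      the length 0 of the empty walk, although \<open>w\<close> differs from
      \<open>u\<close>.\<close>
    from not_single_vertex[of u] u obtain x where x: "x \<in> pverts G" "u \<noteq> x"
      by blast
    obtain w where w: "(u, w) \<in> parcs G"
      using ex_closer_successor[OF reach[OF u x(1)] x(2)] by auto
    then have "w \<in> pverts G" "w \<noteq> u"
      using pair_no_loops[OF w] by (auto dest: in_arcsD2)
    then have "0 < graph_dist G w u"
      using unit_distance_pos[OF reach[OF _ u]] by (simp add: graph_dist_def)
    moreover have "graph_dist G u u \<le> 0"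
      using unit_distance_le_length[of u "[]" u] u
      by (simp add: graph_dist_def awalk_Nil_iff zero_ereal_def)
    ultimately show False
      using le[OF w] \<open>u = v\<close> by auto
  qed
  then obtain w where w: "(u, w) \<in> parcs G" "graph_dist G w v < graph_dist G u v"
    using ex_closer_successor[OF reach[OF u v]] by (auto simp: graph_dist_def)
  have nb: "x \<in> pverts G" if "x \<in> neighbors G u" for x
    using that by (auto simp: neighbors_def dest: in_arcsD2)
  have D_le: "real (D x) \<le> real (D u)" if "x \<in> neighbors G u" for x
    using that le[of x] D[OF nb[OF that]] D[OF u] by (simp add: neighbors_def)
  have w_nb: "w \<in> neighbors G u"
    using w(1) by (simp add: neighbors_def)
  have "real (D w) < real (D u)"
    using w(2) D[OF nb[OF w_nb]] D[OF u] by simp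
  with locally_finite[OF u] D_le w_nb
  have "1 / real (card (neighbors G u)) * (\<Sum>x\<in>neighbors G u. real (D x)) < real (D u)"
    by (rule average_less)
  moreover have "(\<Sum>x\<in>neighbors G u. graph_dist G x v)
      = ereal (\<Sum>x\<in>neighbors G u. real (D x))"
    using D nb by (simp flip: sum_ereal)
  ultimately have "ereal (1 / real (degree G u)) * (\<Sum>x\<in>neighbors G u. graph_dist G x v)
      < graph_dist G u v"
    using D[OF u] by (simp add: degree_def)
  with u v show "u \<in> graph_boundary G"
    by (auto simp: graph_boundary_def)
qed

end
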